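(* Let $\Pi$ be the map on $\mathbb{N}=\{1,2,3,\dots\}$ produced by the following procedure. At step $1$ set $\Pi(1)=1$. For $m=2,3,4,\dots$ in turn, at step $m$: if $\Pi(m-\lfloor m/2\rfloor)$ has not been assigned at an earlier step, set $\Pi(m-\lfloor m/2\rfloor)=m$; otherwise set $\Pi(m+\lfloor m/2\rfloor)=m$. Let $\sigma$ be the morphism of the free monoid $\{1,3,4\}^*$ given by $\sigma(1)=114$, $\sigma(3)=314$, $\sigma(4)=314$, and let $s=s_1s_2s_3\dots=114114314\dots$ be the fixed point of $\sigma$ with first letter $1$. Then for every $n\ge1$: $s_n=1$ iff $\Pi(n)$ has type (I); $s_n=3$ iff $\Pi(n)$ has type (III); $s_n=4$ iff $\Pi(n)$ has type (IV).
   Context: The procedure assigns a value $\Pi(n)$ to every $n\in\mathbb{N}$. Types: for $n\ge 2$, $\Pi(n)$ has type (I) if $\Pi(n)>n$ and $\Pi(n)=2n-1$; type (II) if $\Pi(n)>n$ and $\Pi(n)=2n$; type (III) if $\Pi(n)<n$ and $\Pi(n)=(2n+1)/3$; type (IV) if $\Pi(n)<n$ and $\Pi(n)=2n/3$. By convention $\Pi(1)=1$ is said to have type (I) (and no other type). *)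

theory Defs
  imports Complex_Main "HOL-Library.Stream"
begin

text \<open>
  \<open>assigned_after m\<close> is the partial map of all values assigned in steps \<open>1, \<dots>, m\<close>.
\<close>

fun assigned_after :: "nat \<Rightarrow> (nat \<rightharpoonup> nat)" where
  "assigned_after 0 = Map.empty"
| "assigned_after (Suc 0) = [1 \<mapsto> 1]"
| "assigned_after (Suc (Suc k)) =
     (let m = Suc (Suc k); f = assigned_after (Suc k)
      in if f (m - m div 2) = None then f(m - m div 2 \<mapsto> m) else f(m + m div 2 \<mapsto> m))"

text \<open>
  The resulting map: the value that \<open>n\<close> carries from some step on.  Such a value exists for
  every \<open>n \<ge> 1\<close> (lemma \<open>procedure_map_eventually\<close>), and no value is ever overwritten
  (lemma \<open>assigned_after_mono\<close>); the argument \<open>0\<close> is never assigned.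
\<close>

definition procedure_map :: "nat \<Rightarrow> nat" where
  "procedure_map n = (THE k. \<forall>\<^sub>F m in sequentially. assigned_after m n = Some k)"

lemma assigned_after_cases:
  "assigned_after m x = Some k \<Longrightarrow> 1 \<le> k \<and> k \<le> m \<and> (x = k - k div 2 \<or> x = k + k div 2)"
proof (induction m arbitrary: x k rule: assigned_after.induct)
  case (3 j)
  show ?case
  proof (cases "assigned_after (Suc j) x = Some k")
    case True
    then show ?thesis using "3.IH"[OF refl True] by auto
  next
    case False
    with "3.prems" show ?thesis
      by (auto simp: Let_def split: if_splits)
  qed
qed (auto split: if_splits)

lemma assigned_after_step:
  assumes "assigned_after m x = Some k"
  shows "assigned_after (Suc m) x = Some k"
proof (cases m)
  case (Suc j)
  let ?m = "Suc (Suc j)"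
  have "k \<le> Suc j" "x = k - k div 2 \<or> x = k + k div 2"
    using assigned_after_cases[OF assms] Suc by auto
  moreover from \<open>k \<le> Suc j\<close> have "k + k div 2 < ?m + ?m div 2"
    using div_le_mono[of k ?m 2] by linarith
  ultimately have "x \<noteq> ?m + ?m div 2" by auto
  with assms show ?thesis unfolding Suc by (auto simp: Let_def)
qed (use assms in simp)

lemma assigned_after_mono:
  assumes "assigned_after m x = Some k" "m \<le> m'"
  shows "assigned_after m' x = Some k"
  using assms(2,1) by (induction rule: dec_induct) (auto intro: assigned_after_step)

lemma assigned_after_total:
  assumes "n \<ge> 1"
  shows "\<exists>k. assigned_after (2 * n - 1) n = Some k"
proof (cases "n = 1")
  case False
  define j where "j = n - 2"
  have j: "n = Suc (Suc j)" using assms False by (simp add: j_def)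
  have e: "2 * n - 1 = Suc (Suc (2 * j + 1))" using j by simp
  have d: "Suc (Suc (2 * j + 1)) - Suc (Suc (2 * j + 1)) div 2 = n" using j by simp
  show ?thesis unfolding e assigned_after.simps Let_def d by auto
qed simp

lemma procedure_map_eqI:
  assumes "assigned_after m n = Some k"
  shows "procedure_map n = k"
  unfolding procedure_map_def
proof (rule the_equality)
  show ev: "\<forall>\<^sub>F m in sequentially. assigned_after m n = Some k"
    using assigned_after_mono[OF assms] by (auto simp: eventually_sequentially)
  fix k' assume "\<forall>\<^sub>F m in sequentially. assigned_after m n = Some k'"
  with ev have "\<forall>\<^sub>F m in sequentially. k' = k"
    by eventually_elim simp
  then show "k' = k" by simp
qed

lemma procedure_map_eventually:
  assumes "n \<ge> 1"
  shows "\<forall>\<^sub>F m in sequentially. assigned_after m n = Some (procedure_map n)"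
proof -
  obtain k where k: "assigned_after (2 * n - 1) n = Some k"
    using assigned_after_total[OF assms] by blast
  then show ?thesis
    using assigned_after_mono[OF k] procedure_map_eqI[OF k] by (auto simp: eventually_sequentially)
qed


datatype ptype = Type_I | Type_II | Type_III | Type_IV

text \<open>By convention the value at \<open>1\<close> has type (I), although \<open>p 1 > 1\<close> fails for the map above.\<close>

fun has_type :: "(nat \<Rightarrow> nat) \<Rightarrow> nat \<Rightarrow> ptype \<Rightarrow> bool" where
  "has_type p n Type_I \<longleftrightarrow> n = 1 \<or> (n \<ge> 2 \<and> p n > n \<and> p n = 2 * n - 1)"
| "has_type p n Type_II \<longleftrightarrow> n \<ge> 2 \<and> p n > n \<and> p n = 2 * n"
| "has_type p n Type_III \<longleftrightarrow> n \<ge> 2 \<and> p n < n \<and> real (p n) = (2 * real n + 1) / 3"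
| "has_type p n Type_IV \<longleftrightarrow> n \<ge> 2 \<and> p n < n \<and> real (p n) = 2 * real n / 3"


datatype letter = L1 | L3 | L4

fun sigma_letter :: "letter \<Rightarrow> letter list" where
  "sigma_letter L1 = [L1, L1, L4]"
| "sigma_letter L3 = [L3, L1, L4]"
| "sigma_letter L4 = [L3, L1, L4]"

definition sigma :: "letter list \<Rightarrow> letter list" where
  "sigma w = concat (map sigma_letter w)"

definition sigma_inf :: "letter stream \<Rightarrow> letter stream" where
  "sigma_inf s = flat (smap sigma_letter s)"

lemma sigma_simps:
  "sigma [] = []" "sigma (u @ v) = sigma u @ sigma v" "sigma [a] = sigma_letter a"
  by (simp_all add: sigma_def)

lemma sigma_letter_conv: "sigma_letter a = [case a of L1 \<Rightarrow> L1 | _ \<Rightarrow> L3, L1, L4]"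
  by (cases a) auto

lemma sigma_inf_Cons: "sigma_inf (a ## s) = sigma_letter a @- sigma_inf s"
  by (simp add: sigma_inf_def sigma_letter_conv)

lemma sigma_inf_shift: "sigma_inf (w @- s) = sigma w @- sigma_inf s"
  by (induction w) (simp_all add: sigma_inf_Cons sigma_def)

lemma sigma_inf_snth: "sigma_inf s !! i = sigma_letter (s !! (i div 3)) ! (i mod 3)"
proof (induction i arbitrary: s rule: less_induct)
  case (less i)
  have len: "length (sigma_letter (shd s)) = 3" by (simp add: sigma_letter_conv)
  have s: "sigma_inf s = sigma_letter (shd s) @- sigma_inf (stl s)"
    using sigma_inf_Cons[of "shd s" "stl s"] by simp
  show ?case
  proof (cases "i < 3")
    case True
    then show ?thesis by (simp add: s len)
  next
    case False
    have d: "i div 3 = Suc ((i - 3) div 3)" and m: "i mod 3 = (i - 3) mod 3"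
      using False by (simp_all add: le_div_geq le_mod_geq)
    have "sigma_inf s !! i = sigma_inf (stl s) !! (i - 3)"
      using False len by (subst s) simp
    also have "\<dots> = sigma_letter (stl s !! ((i - 3) div 3)) ! ((i - 3) mod 3)"
      using False by (intro less.IH) simp
    finally show ?thesis unfolding d m snth.simps .
  qed
qed

lemma snth_eqI: "(\<And>i. s !! i = t !! i) \<Longrightarrow> s = t"
  using smap_alt[of id s t] by (simp add: stream.map_id)

fun fixed_letter :: "nat \<Rightarrow> letter" where
  "fixed_letter i = (if i = 0 then L1 else sigma_letter (fixed_letter (i div 3)) ! (i mod 3))"

declare fixed_letter.simps [simp del]

lemma fixed_letter_0: "fixed_letter 0 = L1"
  by (subst fixed_letter.simps) simp

lemma sigma_inf_fixed_point_unique: "\<exists>!s. sigma_inf s = s \<and> shd s = L1"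
proof (rule ex_ex1I)
  let ?s = "smap fixed_letter nats"
  have nth: "?s !! i = fixed_letter i" for i by simp
  have "sigma_inf ?s !! i = ?s !! i" for i
  proof -
    have "sigma_inf ?s !! i = sigma_letter (fixed_letter (i div 3)) ! (i mod 3)"
      by (simp only: sigma_inf_snth nth)
    also have "\<dots> = fixed_letter i"
    proof (cases "i = 0")
      case True
      then show ?thesis by (simp add: fixed_letter_0)
    next
      case False
      then show ?thesis by (subst (2) fixed_letter.simps) simp
    qed
    finally show ?thesis by (simp only: nth)
  qed
  then have "sigma_inf ?s = ?s" by (rule snth_eqI)
  moreover have "shd ?s = L1" by (simp add: fixed_letter_0)
  ultimately show "\<exists>s. sigma_inf s = s \<and> shd s = L1" by blast
next
  fix s t assume s: "sigma_inf s = s \<and> shd s = L1" and t: "sigma_inf t = t \<and> shd t = L1"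
  have "s !! i = t !! i" for i
  proof (induction i rule: less_induct)
    case (less i)
    show ?case
    proof (cases "i = 0")
      case True
      then show ?thesis using s t by simp
    next
      case False
      then have "s !! (i div 3) = t !! (i div 3)" using less.IH by simp
      then show ?thesis
        using s t sigma_inf_snth[of s i] sigma_inf_snth[of t i] by simp
    qed
  qed
  then show "s = t" by (rule snth_eqI)
qed

end

theory Submission
  imports Defs
begin

text \<open>
  Step \<open>2 * n - 1\<close> finds position \<open>n\<close> free unless it already carries a smaller value, so step
  \<open>2 * n\<close> always finds it occupied and type (II) never occurs.  Hence \<open>3 * k\<close> receives \<open>2 * k\<close>,
  positions congruent to \<open>2\<close> modulo \<open>3\<close> are out of reach of the moves to the right, and
  \<open>3 * k + 1\<close> receives \<open>2 * k + 1\<close> exactly if \<open>k + 1\<close> was occupied before step \<open>2 * k + 1\<close>, that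
  is, unless \<open>k + 1\<close> has type (I).  This is the recursion of the fixed point of the morphism.
\<close>

text \<open>Written so that step 1 obeys the general rule: \<open>left_free 1\<close> holds and
  \<open>1 - 1 div 2 = 1\<close>.\<close>

definition left_free :: "nat \<Rightarrow> bool" where
  "left_free m \<longleftrightarrow> assigned_after (m - 1) (m - m div 2) = None"

lemma assigned_after_Suc:
  "assigned_after (Suc k) =
     (if left_free (Suc k) then (assigned_after k)(Suc k - Suc k div 2 \<mapsto> Suc k)
      else (assigned_after k)(Suc k + Suc k div 2 \<mapsto> Suc k))"
  by (cases k) (simp_all add: left_free_def Let_def)

text \<open>Sharpens \<open>assigned_after_cases\<close>: the value k is written only at step k, on
  the side that \<open>left_free k\<close> selects.\<close>

lemma assigned_after_position:
  assumes "assigned_after m x = Some k"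
  shows "x = (if left_free k then k - k div 2 else k + k div 2)"
  using assms
  by (induction m)
    (auto simp: assigned_after_Suc simp del: assigned_after.simps(2-) split: if_splits)

lemma procedure_map_position:
  assumes "k \<ge> 1"
  shows "procedure_map (if left_free k then k - k div 2 else k + k div 2) = k"
proof -
  obtain j where "k = Suc j" using assms by (cases k) auto
  then show ?thesis
    by (intro procedure_map_eqI[of k]) (simp del: assigned_after.simps(2-) add: assigned_after_Suc)
qed

lemma procedure_map_left_or_right:
  assumes "n \<ge> 1"
  shows "procedure_map n = 2 * n - 1 \<or>
         \<not> left_free (procedure_map n) \<and> n = procedure_map n + procedure_map n div 2"
proof -
  obtain k where k: "assigned_after (2 * n - 1) n = Some k"
    using assigned_after_total[OF assms] by blast
  have "1 \<le> k" "k \<le> 2 * n - 1" using assigned_after_cases[OF k] by simp_all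
  \<comment> \<open>The equation leaves only k = 2n - 1 and k = 2n; the bound on k excludes
    2n.\<close>
  then have "k = 2 * n - 1" if "n = k - k div 2"
    using that by presburger
  with assigned_after_position[OF k] procedure_map_eqI[OF k] show ?thesis
    by (cases "left_free k") auto
qed

lemma not_left_free_even:
  assumes "k \<ge> 1"
  shows "\<not> left_free (2 * k)"
  using assigned_after_total[OF assms] by (auto simp: left_free_def)

text \<open>Trades the state before a step for a value of the final map. A value already present is
  at most 2k and permanent.\<close>

lemma left_free_odd_iff: "left_free (2 * k + 1) \<longleftrightarrow> procedure_map (k + 1) = 2 * k + 1"
proof
  assume "left_free (2 * k + 1)"
  then show "procedure_map (k + 1) = 2 * k + 1"
    using procedure_map_position[of "2 * k + 1"] by simp
next
  assume eq: "procedure_map (k + 1) = 2 * k + 1"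
  show "left_free (2 * k + 1)"
  proof (rule ccontr)
    assume "\<not> left_free (2 * k + 1)"
    then obtain v where v: "assigned_after (2 * k) (k + 1) = Some v"
      by (auto simp: left_free_def)
    then show False
      using assigned_after_cases[OF v] procedure_map_eqI[OF v] eq by simp
  qed
qed

lemma procedure_map_mod0:
  assumes "k \<ge> 1"
  shows "procedure_map (3 * k) = 2 * k"
  using procedure_map_position[of "2 * k"] not_left_free_even[OF assms] assms by simp

lemma procedure_map_mod1:
  "procedure_map (3 * k + 1) = (if procedure_map (k + 1) = 2 * k + 1 then 6 * k + 1 else 2 * k + 1)"
proof (cases "left_free (2 * k + 1)")
  case True
  \<comment> \<open>Only 2k + 1 could reach 3k + 1 by a right move, and here it moves left.\<close>
  have "procedure_map (3 * k + 1) = 2 * k + 1"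
    if "3 * k + 1 = procedure_map (3 * k + 1) + procedure_map (3 * k + 1) div 2"
    using that by presburger
  then show ?thesis
    using procedure_map_left_or_right[of "3 * k + 1"] True left_free_odd_iff[of k] by auto
next
  case False
  then show ?thesis
    using procedure_map_position[of "2 * k + 1"] left_free_odd_iff[of k] by simp
qed

lemma procedure_map_mod2: "procedure_map (3 * k + 2) = 6 * k + 3"
proof -
  \<comment> \<open>The right side is 3b for v = 2b and 3b + 1 for v = 2b + 1.\<close>
  have "3 * k + 2 \<noteq> v + v div 2" for v :: nat
  proof (cases "even v")
    case True
    then obtain b where "v = 2 * b" by blast
    then show ?thesis by simp presburger
  next
    case False
    then obtain b where "v = 2 * b + 1" by (blast elim: oddE)
    then show ?thesis by simp presburger
  qed
  then show ?thesis using procedure_map_left_or_right[of "3 * k + 2"] by auto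
qed

lemma fixed_point_snth_times3:
  assumes "sigma_inf s = s"
  shows "s !! (3 * k) = (if s !! k = L1 then L1 else L3)"
    and "s !! (3 * k + 1) = L1"
    and "s !! (3 * k + 2) = L4"
proof -
  have "s !! (3 * k + r) = [if s !! k = L1 then L1 else L3, L1, L4] ! r" if "r < 3" for r
    using sigma_inf_snth[of s "3 * k + r"] assms that
    by (simp add: sigma_letter_conv split: letter.split del: snth.simps)
  from this[of 0] this[of 1] this[of 2]
  show "s !! (3 * k) = (if s !! k = L1 then L1 else L3)" "s !! (3 * k + 1) = L1"
    "s !! (3 * k + 2) = L4"
    by simp_all
qed

text \<open>Streams count from 0, so index i belongs to argument i + 1. Both sides obey one
  recursion: at 3k they repeat their truth value at k, at 3k + 1 they hold, at 3k + 2 they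
  fail.\<close>

lemma fixed_point_L1_iff:
  assumes fp: "sigma_inf s = s" and hd: "shd s = L1"
  shows "s !! i = L1 \<longleftrightarrow> procedure_map (i + 1) = 2 * i + 1"
proof (induction i rule: less_induct)
  case (less i)
  define k where "k = i div 3"
  consider "i = 3 * k" | "i = 3 * k + 1" | "i = 3 * k + 2" unfolding k_def by linarith
  then show ?case
  proof cases
    case 1
    show ?thesis
    proof (cases "k = 0")
      case True
      then show ?thesis using 1 hd procedure_map_mod1[of 0] by (simp split: if_splits)
    next
      case False
      with less.IH[of k] 1 show ?thesis
        using fixed_point_snth_times3(1)[OF fp, of k] procedure_map_mod1[of k] by simp
    qed
  next
    case 2
    then show ?thesis
      using fixed_point_snth_times3(2)[OF fp, of k] procedure_map_mod2[of k] by simp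
  next
    case 3
    then have "i + 1 = 3 * (k + 1)" by simp
    then have "procedure_map (i + 1) = 2 * (k + 1)" using procedure_map_mod0[of "k + 1"] by (simp only:)
    then show ?thesis
      using 3 fixed_point_snth_times3(3)[OF fp, of k] by simp
  qed
qed

theorem theorem2:
  fixes s :: "letter stream" and n :: nat
  assumes "sigma_inf s = s" and "shd s = L1"
    and "n \<ge> 1"
  shows "(s !! (n - 1) = L1 \<longleftrightarrow> has_type procedure_map n Type_I) \<and>
         (s !! (n - 1) = L3 \<longleftrightarrow> has_type procedure_map n Type_III) \<and>
         (s !! (n - 1) = L4 \<longleftrightarrow> has_type procedure_map n Type_IV)"
proof -
  note letters = fixed_point_snth_times3[OF assms(1)]
  define k where "k = (n - 1) div 3"
  have "n = 3 * k + 1 \<or> n = 3 * k + 2 \<or> n = 3 * (k + 1)"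
    unfolding k_def using assms(3) by presburger
  then consider "n = 3 * k + 1" | "n = 3 * k + 2" | "n = 3 * (k + 1)" by blast
  then show ?thesis
  proof cases
    case 1
    show ?thesis
    \<comment> \<open>k = 0 is the convention for n = 1. Otherwise 6k + 1 = 2n - 1 is type (I) and
      2k + 1 = (2n + 1)/3 is type (III).\<close>
    proof (cases "k = 0")
      case True
      then show ?thesis using 1 assms(2) by simp
    next
      case False
      then show ?thesis
        using 1 letters(1)[of k] procedure_map_mod1[of k] fixed_point_L1_iff[OF assms(1,2), of k]
        by simp
    qed
  next
    case 2
    then show ?thesis using letters(2)[of k] procedure_map_mod2[of k] by simp
  next
    case 3
    then show ?thesis using letters(3)[of k] procedure_map_mod0[of "k + 1"] by simp
  qed
qed

end
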